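(* Let $t \ge 2$ be an integer. The class of $\{\text{diamond}, \mathrm{hammer}(t)^+\}$-free graphs is $t$-strongly Pollyanna.
   Context: All graphs are finite, simple and undirected; "$H$-free" means having no induced subgraph isomorphic to $H$, and $\mathcal{H}$-free means $H$-free for every $H\in\mathcal{H}$. $\chi(G)$ is the chromatic number and $\omega(G)$ the clique number. The diamond is $K_4$ minus one edge. For an integer $t$, $\mathrm{hammer}(t)^+$ is the graph consisting of an induced path $u_0u_1u_2u_3$ and a clique $K_t$ disjoint from it, where $u_3$ is adjacent to every vertex of the $K_t$ and there are no other edges. For an integer $n$, $\chi^{(n)}(G)$ denotes the maximum chromatic number of an induced subgraph $H$ of $G$ with $\omega(H)\le n$. A class $\mathcal{F}$ of graphs is $n$-good if it is hereditary (closed under induced subgraphs) and there is a constant $m$ with $\chi^{(n)}(G)\le m$ for all $G\in\mathcal{F}$. A hereditary class is polynomially $\chi$-bounded if there is a polynomial $f$ with $\chi(G)\le f(\omega(G))$ for every graph $G$ in the class. A class $\mathcal{C}$ is $n$-strongly Pollyanna if for every $n$-good class $\mathcal{F}$, the class $\mathcal{C}\cap\mathcal{F}$ is polynomially $\chi$-bounded. *)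

theory Defs
  imports
    Complex_Main
    "HOL-Computational_Algebra.Polynomial"
    "Graph_Theory.Graph_Theory"
begin

text \<open>
  A finite simple undirected graph is a \<open>'a pair_pre_digraph\<close> satisfying the locale predicate
  \<^const>\<open>pair_graph\<close>: a finite vertex set with a symmetric, irreflexive adjacency relation
  \<^const>\<open>parcs\<close> on it. The graph without vertices is allowed.

  A class of graphs is a set of graphs over a vertex type \<open>'a\<close>. The type is arbitrary; over
  \<^typ>\<open>nat\<close>, every finite graph occurs up to isomorphism. Classes are not required to be closed
  under isomorphism.
\<close>

type_synonym 'a graph = "'a pair_pre_digraph"

definition proper_coloring :: "'a graph \<Rightarrow> nat \<Rightarrow> ('a \<Rightarrow> nat) \<Rightarrow> bool" where
  "proper_coloring G k c \<longleftrightarrow>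
     (\<forall>v\<in>pverts G. c v < k) \<and> (\<forall>(u, v)\<in>parcs G. c u \<noteq> c v)"

definition chromatic_number :: "'a graph \<Rightarrow> nat" where
  "chromatic_number G = (LEAST k. \<exists>c. proper_coloring G k c)"

definition is_clique :: "'a graph \<Rightarrow> 'a set \<Rightarrow> bool" where
  "is_clique G S \<longleftrightarrow> S \<subseteq> pverts G \<and> (\<forall>u\<in>S. \<forall>v\<in>S. u \<noteq> v \<longrightarrow> (u, v) \<in> parcs G)"

definition clique_number :: "'a graph \<Rightarrow> nat" where
  "clique_number G = Max {card S | S. is_clique G S}"

definition bounded_clique_chromatic_number :: "nat \<Rightarrow> 'a graph \<Rightarrow> nat" where
  "bounded_clique_chromatic_number n G =
     Max {chromatic_number H | H :: 'a graph.
            induced_subgraph (with_proj H) (with_proj G) \<and> clique_number H \<le> n}"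

definition contains_induced :: "'a graph \<Rightarrow> 'b graph \<Rightarrow> bool" where
  "contains_induced G H \<longleftrightarrow>
     (\<exists>G' :: 'a graph. induced_subgraph (with_proj G') (with_proj G)
        \<and> digraph_iso (with_proj H) (with_proj G'))"

definition free_class :: "'b graph set \<Rightarrow> 'a graph set" where
  "free_class \<H> = {G. pair_graph G \<and> (\<forall>H\<in>\<H>. \<not> contains_induced G H)}"

definition diamond :: "nat graph" where
  "diamond = mk_symmetric (with_proj
     \<lparr> pverts = {0, 1, 2, 3}, parcs = {(0, 1), (0, 2), (0, 3), (1, 2), (1, 3)} \<rparr>)"

text \<open>The vertices 0, 1, 2, 3 are the path and 4, ..., t + 3 are the vertices of the \<open>K\<^sub>t\<close>.\<close>

definition hammer_plus :: "nat \<Rightarrow> nat graph" where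
  "hammer_plus t = mk_symmetric (with_proj
     \<lparr> pverts = {0..<t + 4},
       parcs = {(0, 1), (1, 2), (2, 3)}
         \<union> {(i, j). 4 \<le> i \<and> i < j \<and> j < t + 4}
         \<union> {(3, j) | j. 4 \<le> j \<and> j < t + 4} \<rparr>)"

definition hereditary :: "'a graph set \<Rightarrow> bool" where
  "hereditary \<F> \<longleftrightarrow>
     (\<forall>G\<in>\<F>. pair_graph G) \<and>
     (\<forall>G\<in>\<F>. \<forall>H :: 'a graph. induced_subgraph (with_proj H) (with_proj G) \<longrightarrow> H \<in> \<F>)"

definition good :: "nat \<Rightarrow> 'a graph set \<Rightarrow> bool" where
  "good n \<F> \<longleftrightarrow>
     hereditary \<F> \<and> (\<exists>m. \<forall>G\<in>\<F>. bounded_clique_chromatic_number n G \<le> m)"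

definition polynomially_chi_bounded :: "'a graph set \<Rightarrow> bool" where
  "polynomially_chi_bounded \<F> \<longleftrightarrow>
     hereditary \<F> \<and>
     (\<exists>f :: real poly. \<forall>G\<in>\<F>. real (chromatic_number G) \<le> poly f (real (clique_number G)))"

definition strongly_pollyanna :: "nat \<Rightarrow> 'a graph set \<Rightarrow> bool" where
  "strongly_pollyanna n \<C> \<longleftrightarrow>
     (\<forall>\<F>. good n \<F> \<longrightarrow> polynomially_chi_bounded (\<C> \<inter> \<F>))"

end

theory Submission
  imports Defs
begin

text \<open>
  Let \<open>K\<close> be a maximum clique of a diamond-free graph, with more than \<open>t\<close> vertices. Every vertex
  outside \<open>K\<close> has at most one neighbour in \<open>K\<close>, and every neighbourhood is a disjoint union of
  cliques. If \<open>k \<in> K\<close> and \<open>k, a, x, y\<close> is a walk with \<open>a \<notin> K\<close> and \<open>x\<close>, \<open>y\<close> at distance at least 2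
  from \<open>K\<close>, then \<open>y\<close> is adjacent to \<open>a\<close>, since otherwise \<open>y, x, a, k\<close> and \<open>t\<close> further vertices
  of \<open>K\<close> induce \<open>hammer(t)\<^sup>+\<close>. Hence no vertex has distance 3 from \<open>K\<close>, and the vertices at distance 2 induce a
  disjoint union of cliques. So the component of \<open>K\<close> needs at most \<open>\<omega> + \<omega>\<^sup>2 + \<omega>\<close> colours, and
  components without \<open>K\<^bsub>t+1\<^esub>\<close> are coloured by the assumption on \<open>\<chi>\<^sup>(\<^sup>t\<^sup>)\<close>.
\<close>

section \<open>Induced subgraphs\<close>

text \<open>\<open>X\<close> is not intersected with \<open>pverts G\<close>, which keeps both
  projections unconditional; results that need a subgraph assume
  \<open>X \<subseteq> pverts G\<close>.\<close>

definition induced_on :: "'a graph \<Rightarrow> 'a set \<Rightarrow> 'a graph" where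
  "induced_on G X = \<lparr>pverts = X, parcs = {(u, v) \<in> parcs G. u \<in> X \<and> v \<in> X}\<rparr>"

lemma induced_on_simps [simp]:
  "pverts (induced_on G X) = X"
  "parcs (induced_on G X) = {(u, v) \<in> parcs G. u \<in> X \<and> v \<in> X}"
  by (simp_all add: induced_on_def)

text \<open>Induced subgraphs are determined by their vertex sets, so statements about them become
  statements about subsets of \<open>pverts G\<close>.\<close>

lemma induced_subgraph_with_proj_iff:
  assumes "pair_wf_digraph G"
  shows "induced_subgraph (with_proj H) (with_proj G) \<longleftrightarrow>
    pverts H \<subseteq> pverts G \<and> H = induced_on G (pverts H)" (is "?L \<longleftrightarrow> ?R")
proof
  assume ?L
  then have "pverts H \<subseteq> pverts G" "parcs H = parcs (induced_on G (pverts H))"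
    by (auto simp: induced_subgraph_def subgraph_def)
  then show ?R
    by (intro conjI) (auto intro: pair_pre_digraph.equality)
next
  assume ?R
  then have *: "pverts H \<subseteq> pverts G" "parcs H = parcs (induced_on G (pverts H))"
    by metis+
  then have "pair_wf_digraph H"
    by unfold_locales auto
  with * assms show ?L
    by (auto simp: induced_subgraph_def subgraph_def wf_digraph_wp_iff)
qed

lemma induced_subgraph_induced_on:
  assumes "pair_wf_digraph G" "X \<subseteq> pverts G"
  shows "induced_subgraph (with_proj (induced_on G X)) (with_proj G)"
  using assms by (simp add: induced_subgraph_with_proj_iff)

lemma induced_subgraph_trans:
  assumes "induced_subgraph A B" "induced_subgraph B C"
  shows "induced_subgraph A C"
  using assms by (auto simp: induced_subgraph_def subgraph_def compatible_def)

lemma free_class_induced_subgraph: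
  assumes "G \<in> free_class \<H>" "induced_subgraph (with_proj H) (with_proj G)" "pair_graph H"
  shows "H \<in> free_class \<H>"
  using assms unfolding free_class_def contains_induced_def
  by (blast intro: induced_subgraph_trans)

lemma contains_induced_mk_symmetricI:
  fixes G :: "'a graph" and f :: "'b :: linorder \<Rightarrow> 'a"
  assumes G: "pair_graph G"
    and A: "\<And>i j. (i, j) \<in> A \<Longrightarrow> i \<in> V \<and> j \<in> V \<and> i < j"
    and V: "\<And>i. i \<in> V \<Longrightarrow> f i \<in> pverts G"
    and f: "\<And>i j. i \<in> V \<Longrightarrow> j \<in> V \<Longrightarrow> i < j \<Longrightarrow>
      f i \<noteq> f j \<and> ((f i, f j) \<in> parcs G \<longleftrightarrow> (i, j) \<in> A)"
  shows "contains_induced G (mk_symmetric (with_proj \<lparr>pverts = V, parcs = A\<rparr>))"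
proof -
  interpret pair_graph G by fact
  let ?H = "mk_symmetric (with_proj \<lparr>pverts = V, parcs = A\<rparr>)"
  have parcs_H: "parcs ?H = A \<union> A\<inverse>"
    by (auto simp: parcs_mk_symmetric)
  have inj: "inj_on f V"
    using f by (metis inj_onI linorder_neqE)
  have iff: "(f i, f j) \<in> parcs G \<longleftrightarrow> (i, j) \<in> parcs ?H" if "i \<in> V" "j \<in> V" for i j
  proof (cases i j rule: linorder_cases)
    case less
    then show ?thesis using f[OF that] A[of j i] by (auto simp: parcs_H)
  next
    case equal
    then show ?thesis using A[of i i] no_loops' by (auto simp: parcs_H)
  next
    case greater
    then show ?thesis using f[of j i] that A[of i j] arcs_symmetric by (auto simp: parcs_H)
  qed
  \<comment> \<open>With tail \<open>fst\<close> and head \<open>snd\<close>, the image under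
    \<open>app_iso\<close> is again of the form \<open>with_proj\<close>.\<close>
  define \<phi> where "\<phi> = \<lparr>iso_verts = f, iso_arcs = map_prod f f, iso_head = snd, iso_tail = fst\<rparr>"
  have sub: "parcs ?H \<subseteq> V \<times> V"
    using A by (auto simp: parcs_H)
  have "wf_digraph (with_proj ?H)"
    unfolding wf_digraph_wp_iff using sub by unfold_locales auto
  moreover have "inj_on (map_prod f f) (parcs ?H)"
    using map_prod_inj_on[OF inj inj] sub by (rule inj_on_subset)
  ultimately have "pre_digraph.digraph_isomorphism (with_proj ?H) \<phi>"
    using inj by (auto simp: pre_digraph.digraph_isomorphism_def \<phi>_def)
  moreover have "with_proj (induced_on G (f ` V)) = app_iso \<phi> (with_proj ?H)"
  proof -
    have "{(u, v) \<in> parcs G. u \<in> f ` V \<and> v \<in> f ` V} = map_prod f f ` parcs ?H" (is "?L = ?R")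
    proof
      show "?L \<subseteq> ?R"
        using iff by force
      show "?R \<subseteq> ?L"
        using iff sub by fastforce
    qed
    then show ?thesis
      by (simp add: with_proj_def app_iso_def \<phi>_def)
  qed
  moreover have "induced_subgraph (with_proj (induced_on G (f ` V))) (with_proj G)"
    using V pair_wf_digraph by (intro induced_subgraph_induced_on) auto
  ultimately show ?thesis
    unfolding contains_induced_def digraph_iso_def by blast
qed

section \<open>Cliques and the clique number\<close>

lemma finite_cliques: "finite (pverts G) \<Longrightarrow> finite {S. is_clique G S}"
  by (rule finite_subset[of _ "Pow (pverts G)"]) (auto simp: is_clique_def)

lemma card_le_clique_number:
  assumes "finite (pverts G)" "is_clique G S"
  shows "card S \<le> clique_number G"
  unfolding clique_number_def using assms finite_cliques[OF assms(1)]
  by (intro Max_ge) (auto simp: setcompr_eq_image)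

lemma clique_number_le:
  assumes "finite (pverts G)" "\<And>S. is_clique G S \<Longrightarrow> card S \<le> n"
  shows "clique_number G \<le> n"
proof -
  \<comment> \<open>The empty clique makes the set under \<open>Max\<close> nonempty, even for the
    graph without vertices.\<close>
  have "is_clique G {}"
    by (simp add: is_clique_def)
  then show ?thesis
    unfolding clique_number_def using assms finite_cliques[OF assms(1)]
    by (subst Max_le_iff) (auto simp: setcompr_eq_image)
qed

lemma is_clique_induced_on_iff:
  "X \<subseteq> pverts G \<Longrightarrow> is_clique (induced_on G X) S \<longleftrightarrow> is_clique G S \<and> S \<subseteq> X"
  by (auto simp: is_clique_def)

section \<open>Colouring vertex sets\<close>

text \<open>Colourings relative to a vertex set of a fixed graph, so that pieces can be combined
  without passing to subgraphs.\<close>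

definition colorable :: "'a graph \<Rightarrow> 'a set \<Rightarrow> nat \<Rightarrow> bool" where
  "colorable G X k \<longleftrightarrow>
    (\<exists>c. (\<forall>v\<in>X. c v < k) \<and> (\<forall>u\<in>X. \<forall>v\<in>X. (u, v) \<in> parcs G \<longrightarrow> c u \<noteq> c v))"

lemma colorable_mono: "colorable G X k \<Longrightarrow> k \<le> l \<Longrightarrow> colorable G X l"
  unfolding colorable_def using less_le_trans by blast

lemma colorable_empty [simp]: "colorable G {} k"
  by (simp add: colorable_def)

lemma colorable_induced_on_iff: "colorable G X k \<longleftrightarrow> (\<exists>c. proper_coloring (induced_on G X) k c)"
  by (auto simp: colorable_def proper_coloring_def)

text \<open>The palettes are disjoint: colours for \<open>B\<close> are shifted by \<open>k\<close>,
  and a vertex in both sets keeps its colour from \<open>A\<close>.\<close>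

lemma colorable_Un:
  assumes "colorable G A k" "colorable G B l"
  shows "colorable G (A \<union> B) (k + l)"
proof -
  from assms obtain c d where
    c: "\<forall>v\<in>A. c v < k" "\<forall>u\<in>A. \<forall>v\<in>A. (u, v) \<in> parcs G \<longrightarrow> c u \<noteq> c v" and
    d: "\<forall>v\<in>B. d v < l" "\<forall>u\<in>B. \<forall>v\<in>B. (u, v) \<in> parcs G \<longrightarrow> d u \<noteq> d v"
    unfolding colorable_def by blast
  have "c u < k + n" "c u \<noteq> k + n" "k + n \<noteq> c u" if "u \<in> A" for u n
    using bspec[OF c(1) that] by auto
  with c(2) d show ?thesis
    unfolding colorable_def
    by (intro exI[of _ "\<lambda>v. if v \<in> A then c v else k + d v"]) auto
qed

text \<open>Without edges between the sets one palette serves both, so splitting off components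
  costs no extra colours.\<close>

lemma colorable_Un_nonadjacent:
  assumes "colorable G A k" "colorable G B k"
    and "\<And>a b. a \<in> A \<Longrightarrow> b \<in> B \<Longrightarrow> (a, b) \<notin> parcs G \<and> (b, a) \<notin> parcs G"
  shows "colorable G (A \<union> B) k"
proof -
  from assms(1,2) obtain c d where
    c: "\<forall>v\<in>A. c v < k" "\<forall>u\<in>A. \<forall>v\<in>A. (u, v) \<in> parcs G \<longrightarrow> c u \<noteq> c v" and
    d: "\<forall>v\<in>B. d v < k" "\<forall>u\<in>B. \<forall>v\<in>B. (u, v) \<in> parcs G \<longrightarrow> d u \<noteq> d v"
    unfolding colorable_def by blast
  then show ?thesis
    unfolding colorable_def using assms(3)
    by (intro exI[of _ "\<lambda>v. if v \<in> A then c v else d v"]) auto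
qed

lemma colorable_UN:
  assumes "finite I" "\<And>i. i \<in> I \<Longrightarrow> colorable G (A i) k"
  shows "colorable G (\<Union>i\<in>I. A i) (card I * k)"
  using assms by (induction I rule: finite_induct) (auto intro: colorable_Un)

context pair_graph
begin

lemma colorable_card:
  assumes "finite X"
  shows "colorable G X (card X)"
proof -
  from ex_bij_betw_finite_nat[OF assms] obtain c where c: "bij_betw c X {0..<card X}"
    by blast
  then have "c v < card X" if "v \<in> X" for v
    using that bij_betwE by fastforce
  moreover have "c u \<noteq> c v" if "u \<in> X" "v \<in> X" "(u, v) \<in> parcs G" for u v
    using that c no_loops' by (metis bij_betw_inv_into_left)
  ultimately show ?thesis
    unfolding colorable_def by blast
qed

lemma finite_subset_pverts: "X \<subseteq> pverts G \<Longrightarrow> finite X"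
  using finite_subset pair_finite_verts by blast

lemma colorable_chromatic_number:
  assumes "X \<subseteq> pverts G"
  shows "colorable G X (chromatic_number (induced_on G X))"
proof -
  \<comment> \<open>\<open>LEAST\<close> needs some number of colours that works; an injective
    colouring provides one.\<close>
  have "\<exists>c. proper_coloring (induced_on G X) (card X) c"
    using colorable_card[OF finite_subset_pverts[OF assms]] by (simp add: colorable_induced_on_iff)
  then have "\<exists>c. proper_coloring (induced_on G X) (chromatic_number (induced_on G X)) c"
    unfolding chromatic_number_def by (rule LeastI)
  then show ?thesis
    by (simp add: colorable_induced_on_iff)
qed

lemma chromatic_number_le:
  assumes "colorable G (pverts G) k"
  shows "chromatic_number G \<le> k"
proof -
  from assms have "\<exists>c. proper_coloring G k c"
    unfolding colorable_def proper_coloring_def by (fastforce dest: in_arcsD1 in_arcsD2)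
  then show ?thesis
    unfolding chromatic_number_def by (rule Least_le)
qed

text \<open>The set under \<open>Max\<close> is finite, as its members are given by subsets of
  \<open>pverts G\<close>, and the subgraph induced on \<open>X\<close> contributes to it.\<close>

lemma colorable_bounded_clique_chromatic_number:
  assumes X: "X \<subseteq> pverts G" and n: "\<And>S. is_clique G S \<Longrightarrow> S \<subseteq> X \<Longrightarrow> card S \<le> n"
  shows "colorable G X (bounded_clique_chromatic_number n G)"
proof -
  let ?\<H> = "{H. induced_subgraph (with_proj H) (with_proj G) \<and> clique_number H \<le> n}"
  have "?\<H> \<subseteq> induced_on G ` Pow (pverts G)"
    using pair_wf_digraph by (auto simp: induced_subgraph_with_proj_iff)
  then have "finite ?\<H>"
    using pair_finite_verts finite_subset by blast
  moreover have "induced_on G X \<in> ?\<H>"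
    using X n pair_wf_digraph
    by (auto simp: induced_subgraph_induced_on is_clique_induced_on_iff finite_subset_pverts
        intro!: clique_number_le)
  ultimately have "chromatic_number (induced_on G X) \<le> bounded_clique_chromatic_number n G"
    unfolding bounded_clique_chromatic_number_def by (intro Max_ge) auto
  then show ?thesis
    using colorable_chromatic_number[OF X] colorable_mono by blast
qed

text \<open>Greedy colouring: a vertex together with its neighbours in \<open>X\<close> forms a clique.\<close>

lemma colorable_disjoint_cliques:
  assumes "X \<subseteq> pverts G"
    and "\<And>x y z. x \<in> X \<Longrightarrow> y \<in> X \<Longrightarrow> z \<in> X \<Longrightarrow> (x, y) \<in> parcs G \<Longrightarrow> (y, z) \<in> parcs G \<Longrightarrow>
      x \<noteq> z \<Longrightarrow> (x, z) \<in> parcs G"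
    and "\<And>S. is_clique G S \<Longrightarrow> S \<subseteq> X \<Longrightarrow> card S \<le> k"
  shows "colorable G X k"
  using finite_subset_pverts[OF assms(1)] assms
proof (induction X rule: finite_induct)
  case empty
  show ?case by simp
next
  case (insert x X)
  have "colorable G X k"
    using insert.prems by (intro insert.IH) (blast+)
  then obtain c where c: "\<forall>v\<in>X. c v < k" "\<forall>u\<in>X. \<forall>v\<in>X. (u, v) \<in> parcs G \<longrightarrow> c u \<noteq> c v"
    unfolding colorable_def by blast
  define N where "N = {v \<in> X. (x, v) \<in> parcs G}"
  have "is_clique G (insert x N)"
    unfolding is_clique_def N_def using insert.prems(1,2) arcs_symmetric
    by (auto; metis insertCI)
  then have "card (insert x N) \<le> k"
    by (rule insert.prems(3)) (auto simp: N_def)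
  moreover have "finite N" "x \<notin> N"
    using insert.hyps by (auto simp: N_def)
  \<comment> \<open>The vertex \<open>x\<close> occupies one place in the clique, so its neighbours
    leave a colour free.\<close>
  ultimately have "card (c ` N) < k"
    using card_image_le[of N c] by simp
  then have "\<not> {..<k} \<subseteq> c ` N"
    using card_mono[of "c ` N" "{..<k}"] \<open>finite N\<close> by auto
  then obtain i where i: "i < k" "i \<notin> c ` N"
    by blast
  have "\<forall>u\<in>insert x X. \<forall>v\<in>insert x X. (u, v) \<in> parcs G \<longrightarrow> (c(x := i)) u \<noteq> (c(x := i)) v"
  proof (intro ballI impI)
    fix u v assume uv: "u \<in> insert x X" "v \<in> insert x X" "(u, v) \<in> parcs G"
    then have "u \<noteq> v" "(v, u) \<in> parcs G"
      using no_loops' arcs_symmetric by blast+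
    with uv c(2) i(2) show "(c(x := i)) u \<noteq> (c(x := i)) v"
      by (auto simp: N_def)
  qed
  then show ?case
    unfolding colorable_def using c(1) i(1) by (intro exI[of _ "c(x := i)"]) auto
qed

section \<open>Excluding the diamond and the hammer\<close>

text \<open>The edge \<open>a b\<close> lies in triangles with \<open>c\<close> and with
  \<open>d\<close>; only the pair \<open>c\<close>, \<open>d\<close> can be the missing edge of a
  diamond. The other inequalities follow from looplessness.\<close>

lemma diamond_freeD:
  assumes "\<not> contains_induced G diamond"
    and "(a, b) \<in> parcs G" "(a, c) \<in> parcs G" "(a, d) \<in> parcs G"
    and "(b, c) \<in> parcs G" "(b, d) \<in> parcs G" "c \<noteq> d"
  shows "(c, d) \<in> parcs G"
proof (rule ccontr)
  assume "(c, d) \<notin> parcs G"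
  have "contains_induced G diamond"
    unfolding diamond_def
    using assms(2-) \<open>(c, d) \<notin> parcs G\<close> no_loops' in_arcsD1 in_arcsD2 pair_graph
    by (intro contains_induced_mk_symmetricI[where f = "\<lambda>i. [a, b, c, d] ! i"])
      (auto simp: numeral_eq_Suc)
  with assms(1) show False
    by contradiction
qed

text \<open>The hypotheses exclude every unwanted edge of the hammer with path
  \<open>y, x, a, k\<close> and clique in \<open>K - {k}\<close>, except \<open>a y\<close>, which
  must therefore be present.\<close>

lemma hammer_plus_freeD:
  assumes free: "\<not> contains_induced G (hammer_plus t)"
    and K: "is_clique G K" "t < card K" "k \<in> K"
    and path: "(k, a) \<in> parcs G" "(a, x) \<in> parcs G" "(x, y) \<in> parcs G"
    and notin: "a \<notin> K" "x \<notin> K" "y \<notin> K"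
    and nadj: "\<And>v. v \<in> K \<Longrightarrow> v \<noteq> k \<Longrightarrow> (v, a) \<notin> parcs G"
      "\<And>v. v \<in> K \<Longrightarrow> (v, x) \<notin> parcs G" "\<And>v. v \<in> K \<Longrightarrow> (v, y) \<notin> parcs G"
    and "y \<noteq> a"
  shows "(a, y) \<in> parcs G"
proof (rule ccontr)
  assume nay: "(a, y) \<notin> parcs G"
  have sym: "(u, v) \<in> parcs G \<longleftrightarrow> (v, u) \<in> parcs G" for u v
    using arcs_symmetric by blast
  have "finite K"
    using K(1) finite_subset_pverts by (simp add: is_clique_def)
  \<comment> \<open>The strict bound \<open>t < card K\<close> pays for the removal of
    \<open>k\<close>.\<close>
  then have "t \<le> card (K - {k})"
    using K by simp
  then obtain C where C: "C \<subseteq> K - {k}" "card C = t" "finite C"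
    by (rule obtain_subset_with_card_n)
  obtain e where e: "bij_betw e {0..<t} C"
    using ex_bij_betw_nat_finite[OF \<open>finite C\<close>] C(2) by blast
  have eC: "e i \<in> K" "e i \<noteq> k" if "i < t" for i
    using bij_betwE[OF e] C(1) that by auto
  have e_inj: "e i \<noteq> e j" if "i < j" "j < t" for i j
    using e that by (metis atLeastLessThan_iff bij_betw_def inj_on_eq_iff le0 less_irrefl less_trans)
  \<comment> \<open>The path is numbered from \<open>y\<close> to \<open>k\<close>, because vertex 3
    of \<open>hammer_plus\<close> carries the clique, whose numbers start at 4.\<close>
  define f where "f i = (if i = 0 then y else if i = 1 then x else if i = 2 then a
    else if i = 3 then k else e (i - 4))" for i :: nat
  have f_path [simp]: "f 0 = y" "f 1 = x" "f (Suc 0) = x" "f 2 = a" "f 3 = k"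
    by (simp_all add: f_def)
  have path_arcs: "(y, x) \<in> parcs G" "(x, a) \<in> parcs G" "(a, k) \<in> parcs G"
    "(y, a) \<notin> parcs G" "(y, k) \<notin> parcs G" "(x, k) \<notin> parcs G" "x \<noteq> y" "x \<noteq> a"
    using path nay nadj K(3) sym no_loops' by blast+
  have clique_arcs: "(y, v) \<notin> parcs G" "(x, v) \<notin> parcs G" "(a, v) \<notin> parcs G" "(k, v) \<in> parcs G"
    if "v \<in> K" "v \<noteq> k" for v
    using that nadj K(1,3) sym unfolding is_clique_def by blast+
  have f_clique: "f i = e (i - 4)" if "4 \<le> i" for i
    using that by (simp add: f_def)
  have "contains_induced G (hammer_plus t)"
    unfolding hammer_plus_def
  proof (rule contains_induced_mk_symmetricI[where f = f, OF pair_graph])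
    fix i assume "i \<in> {0..<t + 4}"
    then show "f i \<in> pverts G"
      using path eC K in_arcsD1 in_arcsD2 by (auto simp: f_def is_clique_def)
  next
    fix i j assume ij: "i \<in> {0..<t + 4}" "j \<in> {0..<t + 4}" "i < j"
    let ?A = "{(0, 1), (1, 2), (2, 3)} \<union> {(i, j). 4 \<le> i \<and> i < j \<and> j < t + 4}
      \<union> {(3, j) | j. 4 \<le> j \<and> j < t + 4}"
    consider (path) "j < 4" | (mixed) "i < 4" "4 \<le> j" | (clique) "4 \<le> i" "4 \<le> j"
      using ij by force
    then show "f i \<noteq> f j \<and> ((f i, f j) \<in> parcs G \<longleftrightarrow> (i, j) \<in> ?A)"
    proof cases
      case path
      then have "i = 0 \<and> (j = 1 \<or> j = 2 \<or> j = 3) \<or> i = 1 \<and> (j = 2 \<or> j = 3) \<or> i = 2 \<and> j = 3"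
        using ij by auto
      then show ?thesis
        using path_arcs notin K(3) \<open>y \<noteq> a\<close> by (elim disjE conjE) auto
    next
      case mixed
      have "e (j - 4) \<in> K" "e (j - 4) \<noteq> k"
        using eC[of "j - 4"] ij mixed by auto
      moreover have "i = 0 \<or> i = 1 \<or> i = 2 \<or> i = 3"
        using mixed by auto
      ultimately show ?thesis
        using mixed(2) ij(2) notin clique_arcs by (elim disjE) (auto simp: f_clique)
    next
      case clique
      then show ?thesis
        using eC[of "i - 4"] eC[of "j - 4"] e_inj[of "i - 4" "j - 4"] ij K(1)
        by (auto simp: f_clique is_clique_def)
    qed
  qed auto
  with free show False
    by contradiction
qed

text \<open>Stated for all \<open>X\<close> because the induction strips vertex sets from
  \<open>X\<close>. The summand \<open>m\<close> covers the case without large cliques, the rest a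
  stripped set.\<close>

lemma colorable_diamond_hammer_plus_free:
  assumes diamond: "\<not> contains_induced G diamond"
    and hammer: "\<not> contains_induced G (hammer_plus t)"
    and m: "\<And>X. X \<subseteq> pverts G \<Longrightarrow> (\<And>S. is_clique G S \<Longrightarrow> S \<subseteq> X \<Longrightarrow> card S \<le> t) \<Longrightarrow>
      colorable G X m"
    and w: "\<And>S. is_clique G S \<Longrightarrow> card S \<le> w"
    and X: "X \<subseteq> pverts G"
  shows "colorable G X (m + (w + w * w + w))"
  using finite_subset_pverts[OF X] X
proof (induction X rule: finite_psubset_induct)
  case (psubset X)
  have sym: "(u, v) \<in> parcs G \<longleftrightarrow> (v, u) \<in> parcs G" for u v
    using arcs_symmetric by blast
  note X = \<open>X \<subseteq> pverts G\<close>
  show ?case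
  proof (cases "\<forall>S. is_clique G S \<and> S \<subseteq> X \<longrightarrow> card S \<le> t")
    case True
    with m[OF X] show ?thesis
      by (auto intro: colorable_mono)
  next
    case False
    let ?\<K> = "\<lambda>S. is_clique G S \<and> S \<subseteq> X"
    from False obtain S\<^sub>0 where "?\<K> S\<^sub>0"
      by blast
    \<comment> \<open>The clique is largest inside \<open>X\<close>, not in all of \<open>G\<close>;
      the bound \<open>w\<close> ensures that a largest one exists.\<close>
    then have "\<exists>K. ?\<K> K \<and> (\<forall>S. ?\<K> S \<longrightarrow> card S \<le> card K)"
      using w by (intro ex_has_greatest_nat[of ?\<K> S\<^sub>0 card "Suc w"]) (auto simp: less_Suc_eq_le)
    then obtain K where K: "is_clique G K" "K \<subseteq> X"
      and max: "\<And>S. is_clique G S \<Longrightarrow> S \<subseteq> X \<Longrightarrow> card S \<le> card K"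
      by blast
    have "t < card K"
      using False max by fastforce
    have "finite K"
      using K(2) X finite_subset_pverts by blast
    have adjK: "(u, v) \<in> parcs G" if "u \<in> K" "v \<in> K" "u \<noteq> v" for u v
      using K(1) that by (simp add: is_clique_def)
    have unique: "k = l"
      if "k \<in> K" "l \<in> K" "(k, v) \<in> parcs G" "(l, v) \<in> parcs G" "v \<in> X - K" for k l v
    proof (rule ccontr)
      assume "k \<noteq> l"
      \<comment> \<open>For other \<open>u\<close>, the edge \<open>k l\<close> lies in triangles
        with \<open>u\<close> and \<open>v\<close>, so \<open>u\<close> and \<open>v\<close> are
        adjacent. Thus \<open>v\<close> would enlarge \<open>K\<close>.\<close>
      have "(u, v) \<in> parcs G" if "u \<in> K" for u
        using diamond_freeD[OF diamond, of k l u v] adjK \<open>k \<noteq> l\<close> that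
          \<open>k \<in> K\<close> \<open>l \<in> K\<close> \<open>(k, v) \<in> parcs G\<close> \<open>(l, v) \<in> parcs G\<close> \<open>v \<in> X - K\<close>
        by (cases "u = k \<or> u = l") auto
      then have "is_clique G (insert v K)"
        using K(1) \<open>v \<in> X - K\<close> X sym by (auto simp: is_clique_def)
      then have "card (insert v K) \<le> card K"
        using max \<open>v \<in> X - K\<close> K(2) by simp
      then show False
        using \<open>finite K\<close> \<open>v \<in> X - K\<close> by simp
    qed
    \<comment> \<open>\<open>N1\<close> and \<open>N2\<close> are the vertices at distance 1 and 2
      from \<open>K\<close> inside \<open>X\<close>.\<close>
    define N where "N k = {v \<in> X - K. (k, v) \<in> parcs G}" for k
    define N1 where "N1 = (\<Union>k\<in>K. N k)"
    define N2 where "N2 = {v \<in> X - K - N1. \<exists>a\<in>N1. (a, v) \<in> parcs G}"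
    \<comment> \<open>By \<open>unique\<close>, \<open>k\<close> is the only neighbour of
      \<open>a\<close> in \<open>K\<close>, while \<open>x\<close> and \<open>y\<close> have none.
      The fact is used to pass \<open>a\<close> along edges of \<open>N2\<close> and to rule out
      distance 3.\<close>
    have third: "(a, y) \<in> parcs G"
      if "a \<in> N1" "x \<in> X - K - N1" "y \<in> X - K - N1" "(a, x) \<in> parcs G" "(x, y) \<in> parcs G" for a x y
    proof -
      obtain k where k: "k \<in> K" "a \<in> N k"
        using \<open>a \<in> N1\<close> by (auto simp: N1_def)
      have "y \<noteq> a"
        using that by blast
      moreover have "(v, a) \<notin> parcs G" if "v \<in> K" "v \<noteq> k" for v
        using unique[of v k a] k that by (auto simp: N_def)
      ultimately show ?thesis
        using that k hammer_plus_freeD[OF hammer K(1) \<open>t < card K\<close> k(1), of a x y]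
        by (auto simp: N1_def N_def)
    qed
    have "colorable G K w"
      using colorable_card[OF \<open>finite K\<close>] w[OF K(1)] colorable_mono by blast
    moreover have "colorable G N1 (w * w)"
    proof -
      have "colorable G (N k) w" if "k \<in> K" for k
      proof (rule colorable_disjoint_cliques)
        show "N k \<subseteq> pverts G"
          using X by (auto simp: N_def)
        fix x y z assume "x \<in> N k" "y \<in> N k" "z \<in> N k" "(x, y) \<in> parcs G" "(y, z) \<in> parcs G" "x \<noteq> z"
        then show "(x, z) \<in> parcs G"
          \<comment> \<open>The edge shared by the two triangles is \<open>k y\<close>.\<close>
          using diamond_freeD[OF diamond, of k y x z] sym by (auto simp: N_def)
      qed (use w in auto)
      then have "colorable G N1 (card K * w)"
        unfolding N1_def by (rule colorable_UN[OF \<open>finite K\<close>])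
      then show ?thesis
        using w[OF K(1)] by (rule colorable_mono[OF _ mult_le_mono1])
    qed
    moreover have "colorable G N2 w"
    proof (rule colorable_disjoint_cliques)
      show "N2 \<subseteq> pverts G"
        using X by (auto simp: N2_def)
      fix x y z assume xyz: "x \<in> N2" "y \<in> N2" "z \<in> N2" "(x, y) \<in> parcs G" "(y, z) \<in> parcs G" "x \<noteq> z"
      then obtain a where a: "a \<in> N1" "(a, x) \<in> parcs G"
        by (auto simp: N2_def)
      \<comment> \<open>Two uses of \<open>third\<close> make \<open>a\<close> a common neighbour of
        \<open>x\<close>, \<open>y\<close>, \<open>z\<close>; the shared edge \<open>a y\<close>
        then gives \<open>x z\<close>.\<close>
      have "(a, y) \<in> parcs G"
        using third[of a x y] a xyz by (auto simp: N2_def)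
      moreover from this have "(a, z) \<in> parcs G"
        using third[of a y z] a xyz by (auto simp: N2_def)
      ultimately show "(x, z) \<in> parcs G"
        using diamond_freeD[OF diamond, of a y x z] a xyz sym by auto
    qed (use w in auto)
    ultimately have col: "colorable G (K \<union> N1 \<union> N2) (w + w * w + w)"
      by (intro colorable_Un)
    define S where "S = K \<union> N1 \<union> N2"
    have "S \<subseteq> X"
      using K(2) by (auto simp: S_def N1_def N2_def N_def)
    have sep: "(u, v) \<notin> parcs G" if "u \<in> S" "v \<in> X - S" for u v
    proof
      assume uv: "(u, v) \<in> parcs G"
      have v: "v \<in> X - K - N1" "v \<notin> N2"
        using that by (auto simp: S_def)
      consider "u \<in> K" | "u \<in> N1" | "u \<in> N2"
        using \<open>u \<in> S\<close> by (auto simp: S_def)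
      then show False
      proof cases
        case 1
        then show False using uv v by (auto simp: N1_def N_def)
      next
        case 2
        then show False using uv v by (auto simp: N2_def)
      next
        case 3
        then obtain a where "a \<in> N1" "(a, u) \<in> parcs G" "u \<in> X - K - N1"
          by (auto simp: N2_def)
        \<comment> \<open>By \<open>third\<close>, \<open>v\<close> would be adjacent to
          \<open>a\<close> and hence lie in \<open>N2\<close>.\<close>
        then show False
          using third[of a u v] uv v by (auto simp: N2_def)
      qed
    qed
    have "K \<noteq> {}"
      using \<open>t < card K\<close> by auto
    then have "X - S \<subset> X"
      using K(2) by (auto simp: S_def)
    then have "colorable G (X - S) (m + (w + w * w + w))"
      using X by (intro psubset.IH) auto
    moreover have "colorable G S (m + (w + w * w + w))"
      using col unfolding S_def by (rule colorable_mono) simp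
    ultimately have "colorable G (S \<union> (X - S)) (m + (w + w * w + w))"
      using sep sym by (intro colorable_Un_nonadjacent) blast+
    then show ?thesis
      using \<open>S \<subseteq> X\<close> by (simp add: Un_absorb1)
  qed
qed

end

theorem theorem2p6:
  fixes t :: nat
  assumes "t \<ge> 2"
  shows "strongly_pollyanna t (free_class {diamond, hammer_plus t} :: 'a graph set)"
  unfolding strongly_pollyanna_def
proof (intro allI impI)
  fix \<F> :: "'a graph set"
  assume "good t \<F>"
  then obtain m where her: "hereditary \<F>"
    and m: "\<And>G. G \<in> \<F> \<Longrightarrow> bounded_clique_chromatic_number t G \<le> m"
    unfolding good_def by blast
  let ?\<C> = "free_class {diamond, hammer_plus t} \<inter> \<F>"
  \<comment> \<open>That an induced subgraph is again a \<open>pair_graph\<close>, as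
    \<open>free_class\<close> demands, comes from its membership in \<open>\<F>\<close>.\<close>
  have "hereditary ?\<C>"
    using her free_class_induced_subgraph unfolding hereditary_def by blast
  \<comment> \<open>Coefficients start with the constant term: \<open>m + 2 * w + w * w\<close> is
    the colour count, with \<open>w\<close> the clique number.\<close>
  moreover have "real (chromatic_number G) \<le> poly [:real m, 2, 1:] (real (clique_number G))"
    if "G \<in> ?\<C>" for G
  proof -
    let ?w = "clique_number G"
    from that her interpret pair_graph G
      by (auto simp: hereditary_def)
    have "colorable G (pverts G) (m + (?w + ?w * ?w + ?w))"
    proof (rule colorable_diamond_hammer_plus_free)
      show "\<not> contains_induced G diamond" "\<not> contains_induced G (hammer_plus t)"
        using that by (auto simp: free_class_def)
      show "colorable G X m"
        if "X \<subseteq> pverts G" "\<And>S. is_clique G S \<Longrightarrow> S \<subseteq> X \<Longrightarrow> card S \<le> t" for X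
        using colorable_bounded_clique_chromatic_number[OF that] m \<open>G \<in> ?\<C>\<close> colorable_mono by blast
    qed (simp_all add: card_le_clique_number pair_finite_verts)
    then have "chromatic_number G \<le> m + (?w + ?w * ?w + ?w)"
      by (rule chromatic_number_le)
    then have "real (chromatic_number G) \<le> real (m + (?w + ?w * ?w + ?w))"
      by (simp only: of_nat_le_iff)
    then show ?thesis
      by (simp add: algebra_simps)
  qed
  ultimately show "polynomially_chi_bounded ?\<C>"
    unfolding polynomially_chi_bounded_def by blast
qed

end
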